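(* Let $R$ be a convex quadrilateral in the $xy$-plane which is not a trapezoid. Then there exists a unique ellipse $E_A$ of minimal area among all ellipses which pass through the four vertices of $R$.
   Context: Ellipses are nondegenerate and include circles; the area of an ellipse is the area of the region it encloses. A trapezoid is a convex quadrilateral with at least one pair of parallel sides (so parallelograms are trapezoids). "Of minimal area" means that the minimum of the area over all ellipses through the four vertices of $R$ is attained, and uniqueness means that it is attained by exactly one such ellipse. *)

theory Defs
  imports "HOL-Analysis.Analysis"
begin

definition vertices :: "(real^2) set \<Rightarrow> (real^2) set" where
  "vertices R = {v. v extreme_point_of R}"

(* R is the closed region. A planar polytope with exactly four extreme points is
   automatically two-dimensional, and no three of the vertices are collinear. *)
definition convex_quadrilateral :: "(real^2) set \<Rightarrow> bool" where
  "convex_quadrilateral R \<longleftrightarrow> polytope R \<and> card (vertices R) = 4"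

(* Two sides are parallel if the lines carrying them are translates of one another.
   Distinct sides never lie on a common line, so this is strict parallelism. *)
definition trapezoid :: "(real^2) set \<Rightarrow> bool" where
  "trapezoid R \<longleftrightarrow> convex_quadrilateral R \<and>
     (\<exists>S T. S edge_of R \<and> T edge_of R \<and> S \<noteq> T \<and>
        affine_parallel (affine hull S) (affine hull T))"

(* The curve: a congruent copy (translation after a rotation or reflection) of
   x^2/a^2 + y^2/b^2 = 1; a circle when a = b. *)
definition ellipse :: "(real^2) set \<Rightarrow> bool" where
  "ellipse E \<longleftrightarrow> (\<exists>(a::real) (b::real) (c::real^2) (f :: real^2 \<Rightarrow> real^2). a > 0 \<and> b > 0 \<and>
     orthogonal_transformation f \<and>
     E = (\<lambda>x. c + f x) ` {x. (x $ 1)\<^sup>2 / a\<^sup>2 + (x $ 2)\<^sup>2 / b\<^sup>2 = 1})"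

definition enclosed_area :: "(real^2) set \<Rightarrow> real" where
  "enclosed_area E = measure lebesgue (inside E)"

definition circumscribed_ellipses :: "(real^2) set \<Rightarrow> (real^2) set set" where
  "circumscribed_ellipses R = {E. ellipse E \<and> vertices R \<subseteq> E}"

end

theory Submission
  imports Defs
begin

text \<open>The two diagonals of a convex quadrilateral cross. Taking them as oblique coordinate axes, and
  scaling them suitably, an affine map turns the vertices into
  \<open>(1, 0)\<close>, \<open>(- 1 / u, 0)\<close>, \<open>(0, 1)\<close>, \<open>(0, - 1 / v)\<close> with \<open>u, v > 0\<close>. Opposite sides are parallel
  exactly when \<open>u = v\<close> or \<open>u * v = 1\<close>, so both equalities are excluded. Affine maps send ellipses to
  ellipses and multiply all areas by the same constant, so it is enough to treat these four points.

  Restricting a conic to the axes determines all its coefficients, up to a common factor, apart from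
  the one of \<open>x * y\<close>. The ellipses through the four points therefore form a one-parameter family, with
  \<open>2 * h\<close> the coefficient of \<open>x * y\<close> and \<open>h\<^sup>2 < u * v\<close> the condition that the quadratic part is positive
  definite (\<open>circumscribed_ellipses_eq_pencil\<close>). Completing the square shows that the area is
  \<open>pi * N h / (u * v - h\<^sup>2) powr (3/2)\<close>, where \<open>N\<close>, a quadratic polynomial in \<open>h\<close>, is minus the
  determinant of the full symmetric matrix of the conic.

  Existence: because \<open>u \<noteq> v\<close> and \<open>u * v \<noteq> 1\<close>, the polynomial \<open>N\<close> is positive on the closed interval
  \<open>h\<^sup>2 \<le> u * v\<close>. So \<open>(u * v - h\<^sup>2) ^ 3 / (N h)\<^sup>2\<close>, which is \<open>(pi / area)\<^sup>2\<close>, is continuous there and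
  vanishes at the end points. It attains its maximum inside.

  Uniqueness: every interior critical point is a zero of
  \<open>G h = (u * v - h\<^sup>2) * N' h + 3 * h * N h\<close>, a cubic with leading coefficient \<open>- 1\<close>. With
  \<open>r = sqrt (u * v)\<close>, positivity of \<open>N\<close> at the end points gives \<open>G r > 0\<close> and \<open>G (- r) < 0\<close>. Since
  \<open>G\<close> tends to \<open>- \<infinity>\<close> on the right and to \<open>\<infinity>\<close> on the left, it has a root on either side of
  \<open>[- r, r]\<close>, and only one root can be left for the interior (\<open>cubic_unique_root\<close>).\<close>


section \<open>Ellipses as affine images of the unit circle\<close>

definition affine_circle :: "real^2 \<Rightarrow> real^2^2 \<Rightarrow> (real^2) set" where
  "affine_circle c M = (\<lambda>x. c + M *v x) ` sphere 0 1"

definition diag2 :: "real \<Rightarrow> real \<Rightarrow> real^2^2" where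
  "diag2 a b = vector [vector [a, 0], vector [0, b]]"

lemma det_diag2: "det (diag2 a b) = a * b"
  by (simp add: diag2_def det_2)

lemma unit_sphere_2: "x \<in> sphere (0::real^2) 1 \<longleftrightarrow> (x$1)\<^sup>2 + (x$2)\<^sup>2 = 1"
  by (simp add: norm_eq_sqrt_inner inner_vec_def sum_2 power2_eq_square)

lemma affine_image_affine_circle:
  "(\<lambda>x. d + P *v x) ` affine_circle c M = affine_circle (d + P *v c) (P ** M)"
  by (simp add: affine_circle_def image_image matrix_vector_right_distrib
      matrix_vector_mul_assoc add.assoc)

text \<open>An orthogonal map preserves the unit sphere, so it can be absorbed before the map \<open>M\<close>.\<close>

lemma affine_circle_orthogonal:
  assumes "orthogonal_matrix Q"
  shows "affine_circle c (M ** Q) = affine_circle c M"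
proof -
  have "orthogonal_transformation ((*v) Q)"
    using assms by (simp add: orthogonal_transformation_matrix)
  then have "surj ((*v) Q)" and norm: "norm (Q *v x) = norm x" for x
    by (auto simp: orthogonal_transformation_surj orthogonal_transformation)
  have "(*v) Q ` sphere 0 1 = sphere 0 1"
  proof (intro subset_antisym subsetI)
    fix y :: "real^2" assume "y \<in> sphere 0 1"
    moreover obtain x where "y = Q *v x" using \<open>surj ((*v) Q)\<close> by (rule surjE)
    ultimately show "y \<in> (*v) Q ` sphere 0 1" using norm[of x] by simp
  qed (use norm in auto)
  then have "(\<lambda>x. c + M *v x) ` ((*v) Q ` sphere 0 1) = affine_circle c M"
    by (simp add: affine_circle_def)
  then show ?thesis
    by (simp add: affine_circle_def image_image matrix_vector_mul_assoc)
qed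

lemma diag2_image_sphere:
  assumes "a > 0" "b > 0"
  shows "(*v) (diag2 a b) ` sphere 0 1 = {x. (x $ 1)\<^sup>2 / a\<^sup>2 + (x $ 2)\<^sup>2 / b\<^sup>2 = 1}"
proof (intro subset_antisym subsetI)
  fix y assume "y \<in> (*v) (diag2 a b) ` sphere 0 1"
  then show "y \<in> {x. (x $ 1)\<^sup>2 / a\<^sup>2 + (x $ 2)\<^sup>2 / b\<^sup>2 = 1}"
    using assms unfolding image_iff Bex_def unit_sphere_2
    by (auto simp: diag2_def matrix_vector_mult_def sum_2 power_mult_distrib)
next
  fix y :: "real^2" assume "y \<in> {x. (x $ 1)\<^sup>2 / a\<^sup>2 + (x $ 2)\<^sup>2 / b\<^sup>2 = 1}"
  then have "vector [y$1 / a, y$2 / b] \<in> sphere (0::real^2) 1"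
    unfolding unit_sphere_2 by (simp add: power_divide)
  moreover have "y = diag2 a b *v vector [y$1 / a, y$2 / b]"
    using assms by (simp add: vec_eq_iff forall_2 diag2_def matrix_vector_mult_def sum_2)
  ultimately show "y \<in> (*v) (diag2 a b) ` sphere 0 1" by blast
qed

text \<open>Some rotated orthonormal frame is sent by \<open>M\<close> to two orthogonal vectors: the inner product of the
  two images changes sign when the frame turns by a right angle, because the images are then swapped
  up to a sign, so it vanishes at some angle in between. The lengths of the images are \<open>a\<close> and \<open>b\<close>.\<close>

lemma singular_value_decomposition_2:
  fixes M :: "real^2^2"
  assumes "det M \<noteq> 0"
  obtains F Q a b where "orthogonal_matrix F" "orthogonal_matrix Q" "a > 0" "b > 0"
    "M ** Q = F ** diag2 a b"
proof -
  define p where "p t = M *v vector [cos t, sin t]" for t :: real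
  define q where "q t = M *v vector [- sin t, cos t]" for t :: real
  have p: "p t $ i = M$i$1 * cos t + M$i$2 * sin t" for t i
    by (simp add: p_def matrix_vector_mult_def sum_2)
  have q: "q t $ i = - M$i$1 * sin t + M$i$2 * cos t" for t i
    by (simp add: q_def matrix_vector_mult_def sum_2)
  define g where "g t = p t $ 1 * q t $ 1 + p t $ 2 * q t $ 2" for t :: real
  have cont: "continuous_on {0..pi/2} g"
    unfolding g_def p q by (intro continuous_intros)
  have g0: "g (pi/2) = - g 0"
    by (simp add: g_def p q algebra_simps)
  obtain t where t: "g t = 0"
  proof (cases "g 0 \<le> 0")
    case True
    then show ?thesis using IVT'[of g 0 0 "pi/2"] cont g0 that by auto
  next
    case False
    then show ?thesis using IVT2'[of g "pi/2" 0 0] cont g0 that by auto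
  qed
  define a b where "a = norm (p t)" and "b = norm (q t)"
  have det: "p t $ 1 * q t $ 2 - p t $ 2 * q t $ 1 = det M"
  proof -
    have "p t $ 1 * q t $ 2 - p t $ 2 * q t $ 1 = det M * ((sin t)\<^sup>2 + (cos t)\<^sup>2)"
      unfolding p q det_2 by algebra
    then show ?thesis by simp
  qed
  have "p t \<noteq> 0" "q t \<noteq> 0" using det assms by auto
  then have ab: "a > 0" "b > 0" by (auto simp: a_def b_def)
  have a2: "(p t $ 1)\<^sup>2 + (p t $ 2)\<^sup>2 = a\<^sup>2"
    by (simp add: a_def norm_eq_sqrt_inner inner_vec_def sum_2 power2_eq_square)
  have b2: "(q t $ 1)\<^sup>2 + (q t $ 2)\<^sup>2 = b\<^sup>2"
    by (simp add: b_def norm_eq_sqrt_inner inner_vec_def sum_2 power2_eq_square)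
  define Q :: "real^2^2" where "Q = vector [vector [cos t, - sin t], vector [sin t, cos t]]"
  define F :: "real^2^2" where "F = vector [vector [p t $ 1 / a, q t $ 1 / b], vector [p t $ 2 / a, q t $ 2 / b]]"
  show thesis
  proof (rule that[of F Q a b])
    have "sin t * sin t + cos t * cos t = 1" "cos t * cos t + sin t * sin t = 1"
      using sin_cos_squared_add[of t] by (simp_all add: power2_eq_square)
    then show "orthogonal_matrix Q"
      unfolding orthogonal_matrix by (simp add: Q_def vec_eq_iff forall_2 matrix_matrix_mult_def sum_2 transpose_def mat_def)
    have "p t $ 1 * p t $ 1 / (a*a) + p t $ 2 * p t $ 2 / (a*a) = 1"
      using a2 ab by (simp add: field_simps power2_eq_square)
    moreover have "q t $ 1 * q t $ 1 / (b*b) + q t $ 2 * q t $ 2 / (b*b) = 1"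
      using b2 ab by (simp add: field_simps power2_eq_square)
    moreover have "p t $ 1 * q t $ 1 / (a*b) + p t $ 2 * q t $ 2 / (a*b) = 0"
      using t ab by (simp add: field_simps g_def)
    moreover have "q t $ 1 * p t $ 1 / (b*a) + q t $ 2 * p t $ 2 / (b*a) = 0"
      using t ab by (simp add: field_simps g_def)
    ultimately show "orthogonal_matrix F"
      unfolding orthogonal_matrix by (simp add: F_def vec_eq_iff forall_2 matrix_matrix_mult_def sum_2 transpose_def mat_def)
    show "M ** Q = F ** diag2 a b"
      using ab by (simp add: F_def Q_def diag2_def vec_eq_iff forall_2 matrix_matrix_mult_def sum_2 p q)
  qed (use ab in auto)
qed

text \<open>This removes the orthogonality requirement from the definition of an ellipse: the singular value
  decomposition turns an arbitrary invertible linear map into an axis-parallel stretch followed by an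
  orthogonal map. In this form invariance under affine maps is evident.\<close>

lemma ellipse_iff_affine_circle:
  "ellipse E \<longleftrightarrow> (\<exists>c M. det M \<noteq> 0 \<and> E = affine_circle c M)"
proof
  assume "ellipse E"
  then obtain a b c and f :: "real^2 \<Rightarrow> real^2" where ab: "a > 0" "b > 0" and f: "orthogonal_transformation f"
    and E: "E = (\<lambda>x. c + f x) ` {x. (x $ 1)\<^sup>2 / a\<^sup>2 + (x $ 2)\<^sup>2 / b\<^sup>2 = 1}"
    unfolding ellipse_def by blast
  have lin: "linear f" and orth: "orthogonal_matrix (matrix f)"
    using f by (auto simp: orthogonal_transformation_matrix)
  have "E = affine_circle c (matrix f ** diag2 a b)"
    unfolding E diag2_image_sphere[OF ab, symmetric] affine_circle_def
    by (simp add: image_image matrix_works lin matrix_vector_mul_assoc[symmetric])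
  moreover have "det (matrix f ** diag2 a b) \<noteq> 0"
    using det_orthogonal_matrix[OF orth] ab by (auto simp: det_mul det_diag2)
  ultimately show "\<exists>c M. det M \<noteq> 0 \<and> E = affine_circle c M" by blast
next
  assume "\<exists>c M. det M \<noteq> 0 \<and> E = affine_circle c M"
  then obtain c M where M: "det M \<noteq> 0" and E: "E = affine_circle c M" by blast
  obtain F Q a b where F: "orthogonal_matrix F" and Q: "orthogonal_matrix Q"
    and ab: "a > 0" "b > 0" and MQ: "M ** Q = F ** diag2 a b"
    using singular_value_decomposition_2[OF M] .
  have "E = affine_circle c (F ** diag2 a b)"
    using E affine_circle_orthogonal[OF Q] MQ by metis
  also have "\<dots> = (\<lambda>x. c + F *v x) ` {x. (x $ 1)\<^sup>2 / a\<^sup>2 + (x $ 2)\<^sup>2 / b\<^sup>2 = 1}"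
    unfolding diag2_image_sphere[OF ab, symmetric] affine_circle_def
    by (simp add: image_image matrix_vector_mul_assoc[symmetric])
  finally show "ellipse E"
    unfolding ellipse_def using ab F
    by (intro exI[of _ a] exI[of _ b] exI[of _ c] exI[of _ "(*v) F"])
      (simp add: orthogonal_transformation_matrix)
qed

text \<open>The curve is the frontier of a bounded convex set, the image of the disc. Hence its inside is the
  interior of that set, whose measure is the determinant times the area of the unit disc.\<close>

lemma enclosed_area_affine_circle:
  assumes "det M \<noteq> 0"
  shows "enclosed_area (affine_circle c M) = pi * \<bar>det M\<bar>"
proof -
  have lin: "linear ((*v) M)" by simp
  have inj: "inj ((*v) M)" using assms det_nz_iff_inj[OF lin] by simp
  let ?D = "(+) c ` (*v) M ` cball 0 1"
  have "frontier ?D = (+) c ` (*v) M ` frontier (cball 0 1)"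
    unfolding frontier_translation unfolding frontier_def
    using lin inj
    by (simp add: closure_injective_linear_image[symmetric] interior_injective_linear_image
        image_set_diff)
  then have E: "affine_circle c M = frontier ?D"
    by (simp add: affine_circle_def image_image)
  have "bounded ?D" "convex ?D"
    using lin by (auto intro!: bounded_translation bounded_linear_image convex_translation convex_linear_image
        simp: linear_conv_bounded_linear)
  then have "inside (affine_circle c M) = interior ?D"
    unfolding E by (rule inside_frontier_eq_interior)
  also have "\<dots> = (+) c ` (*v) M ` ball 0 1"
    using lin inj by (simp add: interior_translation interior_injective_linear_image)
  finally show ?thesis
    by (simp add: enclosed_area_def measure_translation measure_linear_image content_ball unit_ball_vol_2)
qed

section \<open>The pencil of conics through four points on the axes\<close>

text \<open>Completing the square. Moving the origin to the center reduces the equation to a quadratic form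
  with value \<open>K\<close>, and \<open>A * x\<^sup>2 + 2 * B * x * y + C * y\<^sup>2 = A * (x + B / A * y)\<^sup>2 + \<delta> / A * y\<^sup>2\<close>
  then exhibits the conic as the image of the unit circle under an upper triangular matrix.\<close>

lemma conic_eq_affine_circle:
  fixes A B C D E F :: real
  defines "\<delta> \<equiv> A * C - B\<^sup>2"
  defines "K \<equiv> F + (C * D\<^sup>2 - 2 * B * D * E + A * E\<^sup>2) / \<delta>"
  assumes "A > 0" "\<delta> > 0" "K > 0"
  obtains c M where "det M = K / sqrt \<delta>"
    "affine_circle c M =
      {z. A * (z$1)\<^sup>2 + 2 * B * z$1 * z$2 + C * (z$2)\<^sup>2 + 2 * D * z$1 + 2 * E * z$2 = F}"
proof -
  \<comment> \<open>the center, where the gradient of the quadratic polynomial vanishes\<close>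
  define cx cy where "cx = (B * E - C * D) / \<delta>" and "cy = (B * D - A * E) / \<delta>"
  define m n where "m = sqrt (K / A)" and "n = sqrt (K * A / \<delta>)"
  define c :: "real^2" where "c = vector [cx, cy]"
  define M :: "real^2^2" where "M = vector [vector [m, - (B / A) * n], vector [0, n]]"
  have mn: "m > 0" "n > 0" "m\<^sup>2 = K / A" "n\<^sup>2 = K * A / \<delta>"
    using assms by (simp_all add: m_def n_def)
  \<comment> \<open>the inverse of the affine map with matrix \<open>M\<close> and translation \<open>c\<close>\<close>
  define X :: "real^2 \<Rightarrow> real^2" where
    "X z = vector [(z$1 - cx + B / A * (z$2 - cy)) / m, (z$2 - cy) / n]" for z
  have X: "z = c + M *v x \<longleftrightarrow> x = X z" for x z
  proof -
    define \<beta> where "\<beta> = B / A"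
    have "x = X z \<longleftrightarrow> m * x$1 = z$1 - cx + \<beta> * (z$2 - cy) \<and> n * x$2 = z$2 - cy"
      using mn by (simp add: X_def vec_eq_iff forall_2 eq_divide_eq mult.commute \<beta>_def[symmetric])
    also have "\<dots> \<longleftrightarrow> z$1 = cx + (m * x$1 - \<beta> * n * x$2) \<and> z$2 = cy + n * x$2"
      by (rule iffI; rule conjI; algebra)
    also have "\<dots> \<longleftrightarrow> z = c + M *v x"
      by (simp add: c_def M_def vec_eq_iff forall_2 matrix_vector_mult_def sum_2 \<beta>_def[symmetric])
    finally show ?thesis by simp
  qed
  have center: "A * cx + B * cy = - D" "B * cx + C * cy = - E"
    "K = F - D * cx - E * cy"
    using \<open>\<delta> > 0\<close> unfolding cx_def cy_def K_def
    by (simp_all add: field_simps) (simp_all add: \<delta>_def algebra_simps power2_eq_square)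
  have conic: "X z \<in> sphere 0 1 \<longleftrightarrow>
      A * (z$1)\<^sup>2 + 2 * B * z$1 * z$2 + C * (z$2)\<^sup>2 + 2 * D * z$1 + 2 * E * z$2 = F" for z
  proof -
    define x y where "x = z$1 - cx" and "y = z$2 - cy"
    have "X z \<in> sphere 0 1 \<longleftrightarrow> (x + B / A * y)\<^sup>2 / m\<^sup>2 + y\<^sup>2 / n\<^sup>2 = 1"
      unfolding unit_sphere_2 by (simp add: X_def x_def y_def power_divide)
    also have "\<dots> \<longleftrightarrow> A * (x + B / A * y)\<^sup>2 + \<delta> / A * y\<^sup>2 = K"
      using assms(3-5) unfolding mn(3,4)
      by (simp add: add_divide_distrib[symmetric] divide_divide_eq_right divide_eq_eq
          mult.commute[of K] add_divide_eq_iff divide_add_eq_iff)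
        (auto simp: field_simps)
    also have "A * (x + B / A * y)\<^sup>2 + \<delta> / A * y\<^sup>2 = A * x\<^sup>2 + 2 * B * x * y + C * y\<^sup>2"
      using assms(3) unfolding \<delta>_def by (simp add: field_simps power2_eq_square)
    also have "\<dots> = A * (z$1)\<^sup>2 + 2 * B * z$1 * z$2 + C * (z$2)\<^sup>2 + 2 * D * z$1 + 2 * E * z$2
        - D * cx - E * cy"
      unfolding x_def y_def using center(1,2) by algebra
    finally show ?thesis using center(3) by auto
  qed
  show thesis
  proof (rule that)
    have "m * n = K / sqrt \<delta>"
    proof -
      have "m * n = sqrt (K\<^sup>2 / \<delta>)"
        using assms(3) by (simp add: m_def n_def real_sqrt_mult[symmetric] power2_eq_square)
      then show ?thesis using assms(5) by (simp add: real_sqrt_divide)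
    qed
    then show "det M = K / sqrt \<delta>" by (simp add: M_def det_2)
    have "affine_circle c M = {z. X z \<in> sphere 0 1}"
      unfolding affine_circle_def image_def X by blast
    then show "affine_circle c M =
      {z. A * (z$1)\<^sup>2 + 2 * B * z$1 * z$2 + C * (z$2)\<^sup>2 + 2 * D * z$1 + 2 * E * z$2 = F}"
      unfolding conic .
  qed
qed

text \<open>If \<open>N\<close> is the inverse of \<open>M\<close>, the curve is given by \<open>norm (N *v (z - c)) = 1\<close>; its quadratic part has
  the Gram matrix of the columns of \<open>N\<close>, whose determinant is the square of that of \<open>N\<close>.\<close>

lemma affine_circle_eq_conic:
  assumes "det M \<noteq> 0"
  obtains A B C D E F where "A > 0" "A * C - B\<^sup>2 > 0"
    "affine_circle c M =
      {z. A * (z$1)\<^sup>2 + 2 * B * z$1 * z$2 + C * (z$2)\<^sup>2 + 2 * D * z$1 + 2 * E * z$2 = F}"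
proof -
  obtain N where N: "M ** N = mat 1" "N ** M = mat 1"
    using assms unfolding invertible_det_nz[symmetric] invertible_def by auto
  have "det N * det M = 1" using N(2) det_mul[of N M] by simp
  then have det: "N$1$1 * N$2$2 - N$1$2 * N$2$1 \<noteq> 0" unfolding det_2[symmetric] by auto
  define e where "e = N *v c"
  have X: "z = c + M *v x \<longleftrightarrow> x = N *v z - e" for x z
  proof
    assume "z = c + M *v x"
    then show "x = N *v z - e"
      by (simp add: e_def matrix_vector_right_distrib matrix_vector_mul_assoc N)
  next
    assume "x = N *v z - e"
    then show "z = c + M *v x"
      by (simp add: e_def matrix_vector_mult_diff_distrib matrix_vector_mul_assoc N)
  qed
  have "affine_circle c M = {z. N *v z - e \<in> sphere 0 1}"
    unfolding affine_circle_def image_def X by blast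
  also have "\<dots> = {z. ((N$1$1)\<^sup>2 + (N$2$1)\<^sup>2) * (z$1)\<^sup>2
      + 2 * (N$1$1 * N$1$2 + N$2$1 * N$2$2) * z$1 * z$2
      + ((N$1$2)\<^sup>2 + (N$2$2)\<^sup>2) * (z$2)\<^sup>2
      + 2 * (- N$1$1 * e$1 - N$2$1 * e$2) * z$1
      + 2 * (- N$1$2 * e$1 - N$2$2 * e$2) * z$2 = 1 - (e$1)\<^sup>2 - (e$2)\<^sup>2}"
    unfolding unit_sphere_2
    by (intro Collect_cong) (simp add: matrix_vector_mult_def sum_2 algebra_simps power2_eq_square)
  finally have eq: "affine_circle c M = \<dots>" .
  have "((N$1$1)\<^sup>2 + (N$2$1)\<^sup>2) * ((N$1$2)\<^sup>2 + (N$2$2)\<^sup>2) - (N$1$1 * N$1$2 + N$2$1 * N$2$2)\<^sup>2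
      = (N$1$1 * N$2$2 - N$1$2 * N$2$1)\<^sup>2"
    by (simp add: algebra_simps power2_eq_square)
  then have pos: "((N$1$1)\<^sup>2 + (N$2$1)\<^sup>2) * ((N$1$2)\<^sup>2 + (N$2$2)\<^sup>2) - (N$1$1 * N$1$2 + N$2$1 * N$2$2)\<^sup>2 > 0"
    using det by simp
  have "N$1$1 \<noteq> 0 \<or> N$2$1 \<noteq> 0" using det by auto
  then have "(N$1$1)\<^sup>2 + (N$2$1)\<^sup>2 > 0" by (simp add: sum_power2_gt_zero_iff)
  from that[OF this pos eq] show thesis .
qed

text \<open>The conics through the four points below. On the axis \<open>z$2 = 0\<close> the equation becomes
  \<open>(z$1 - 1) * (u * z$1 + 1) = 0\<close>, and symmetrically on the other axis.\<close>

definition pencil_conic :: "real \<Rightarrow> real \<Rightarrow> real \<Rightarrow> (real^2) set" where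
  "pencil_conic u v h =
    {z. u * (z$1)\<^sup>2 + 2 * h * z$1 * z$2 + v * (z$2)\<^sup>2 + (1 - u) * z$1 + (1 - v) * z$2 = 1}"

text \<open>The parameters are reciprocals of distances because \<open>u\<close> and \<open>v\<close> are then the coefficients of the
  squares in the equation of the conic.\<close>

definition axis_quadrilateral :: "real \<Rightarrow> real \<Rightarrow> (real^2) set" where
  "axis_quadrilateral u v = {vector [1, 0], vector [- 1 / u, 0], vector [0, 1], vector [0, - 1 / v]}"

text \<open>Minus the determinant of the symmetric 3 by 3 matrix of the conic, whose linear part is
  \<open>((1 - u) / 2, (1 - v) / 2)\<close> and whose constant term is \<open>- 1\<close>.\<close>

definition pencil_det :: "real \<Rightarrow> real \<Rightarrow> real \<Rightarrow> real" where
  "pencil_det u v h = u * v - h\<^sup>2 + (v * (1 - u)\<^sup>2 - 2 * h * (1 - u) * (1 - v) + u * (1 - v)\<^sup>2) / 4"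

text \<open>For \<open>h\<^sup>2 < u * v\<close> this is the square of \<open>pi\<close> divided by the area enclosed by the conic. Unlike the
  area itself it is a rational function of \<open>h\<close>, and without parallel sides it is continuous up to
  \<open>h\<^sup>2 = u * v\<close>, where it vanishes because the area of the ellipse tends to infinity.\<close>

definition inv_area_sq :: "real \<Rightarrow> real \<Rightarrow> real \<Rightarrow> real" where
  "inv_area_sq u v h = (u * v - h\<^sup>2) ^ 3 / (pencil_det u v h)\<^sup>2"

lemma axis_quadrilateral_subset_pencil_conic:
  assumes "u > 0" "v > 0"
  shows "axis_quadrilateral u v \<subseteq> pencil_conic u v h"
  using assms by (simp add: axis_quadrilateral_def pencil_conic_def field_simps power2_eq_square)

text \<open>The two points on each axis determine the square and the linear coefficients in terms of the
  constant \<open>F\<close>, so after division by \<open>F\<close> only the mixed coefficient is free.\<close>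

lemma affine_circle_through_axis_quadrilateral:
  assumes "u > 0" "v > 0" "det M \<noteq> 0" "axis_quadrilateral u v \<subseteq> affine_circle c M"
  obtains h where "h\<^sup>2 < u * v" "affine_circle c M = pencil_conic u v h"
proof -
  obtain A B C D E F where A: "A > 0" and pos: "A * C - B\<^sup>2 > 0" and eq: "affine_circle c M =
      {z. A * (z$1)\<^sup>2 + 2 * B * z$1 * z$2 + C * (z$2)\<^sup>2 + 2 * D * z$1 + 2 * E * z$2 = F}"
    using affine_circle_eq_conic[OF assms(3)] .
  have 1: "A + 2 * D = F" "C + 2 * E = F"
    using assms(4) unfolding eq axis_quadrilateral_def by auto
  have 2: "A - 2 * D * u = F * u\<^sup>2" "C - 2 * E * v = F * v\<^sup>2"
    using assms(1,2,4) unfolding eq axis_quadrilateral_def by (auto simp: field_simps power2_eq_square)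
  have "A * (1 + u) = u * (A + 2 * D) + (A - 2 * D * u)" by (simp add: algebra_simps)
  then have "A * (1 + u) = F * u * (1 + u)" unfolding 1 2 by (simp add: algebra_simps power2_eq_square)
  moreover have "C * (1 + v) = v * (C + 2 * E) + (C - 2 * E * v)" by (simp add: algebra_simps)
  then have "C * (1 + v) = F * v * (1 + v)" unfolding 1 2 by (simp add: algebra_simps power2_eq_square)
  ultimately have AC: "A = F * u" "C = F * v" using assms(1,2) by auto
  then have F: "F > 0" using A assms(1) by (simp add: zero_less_mult_iff)
  show thesis
  proof (rule that)
    have "B\<^sup>2 < F\<^sup>2 * (u * v)" using pos unfolding AC by (simp add: algebra_simps power2_eq_square)
    then show "(B / F)\<^sup>2 < u * v" using F by (simp add: field_simps)
    have "A * x\<^sup>2 + 2 * B * x * y + C * y\<^sup>2 + 2 * D * x + 2 * E * y =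
        F * (u * x\<^sup>2 + 2 * (B / F) * x * y + v * y\<^sup>2 + (1 - u) * x + (1 - v) * y)" for x y
    proof -
      have DE: "2 * D = F * (1 - u)" "2 * E = F * (1 - v)"
        using 1 AC by (simp_all add: algebra_simps)
      show ?thesis unfolding DE AC using F by (simp add: algebra_simps)
    qed
    then show "affine_circle c M = pencil_conic u v (B / F)"
      unfolding eq pencil_conic_def using F by simp
  qed
qed

text \<open>Up to the factor \<open>4 * u\<close> the determinant is \<open>u * v - h\<^sup>2\<close> times a positive number plus a square.
  Where \<open>h\<^sup>2 = u * v\<close> only the square remains, and it vanishes there only if
  \<open>(u - v) * (1 - u * v) = 0\<close>, that is, if two opposite sides are parallel.\<close>

lemma pencil_det_pos:
  assumes "u > 0" "v > 0" "u \<noteq> v" "u * v \<noteq> 1" "h\<^sup>2 \<le> u * v"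
  shows "pencil_det u v h > 0"
proof -
  have id: "4 * u * pencil_det u v h
      = (u * v - h\<^sup>2) * (4 * u + (1 - u)\<^sup>2) + (u * (1 - v) - h * (1 - u))\<^sup>2"
    by (simp add: pencil_det_def field_simps power2_eq_square)
  have "\<dots> > 0"
  proof (cases "h\<^sup>2 = u * v")
    case False
    then have "(u * v - h\<^sup>2) * (4 * u + (1 - u)\<^sup>2) > 0"
      using assms by (intro mult_pos_pos add_pos_nonneg) auto
    then show ?thesis by (simp add: add_pos_nonneg)
  next
    case True
    have "u * (1 - v) - h * (1 - u) \<noteq> 0"
    proof
      assume "u * (1 - v) - h * (1 - u) = 0"
      then have "(u * (1 - v))\<^sup>2 = h\<^sup>2 * (1 - u)\<^sup>2" by algebra
      then have "u * ((u - v) * (1 - u * v)) = 0" using True by algebra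
      then show False using assms by simp
    qed
    then show ?thesis using True by simp
  qed
  then show ?thesis using assms(1) unfolding id[symmetric] by (simp add: zero_less_mult_iff)
qed

lemma inv_area_sq_pos:
  assumes "u > 0" "v > 0" "u \<noteq> v" "u * v \<noteq> 1" "h\<^sup>2 < u * v"
  shows "inv_area_sq u v h > 0"
  using pencil_det_pos[of u v h] assms by (simp add: inv_area_sq_def)

lemma pencil_conic_eq_affine_circle:
  assumes "u > 0" "v > 0" "u \<noteq> v" "u * v \<noteq> 1" "h\<^sup>2 < u * v"
  obtains c M where "det M = 1 / sqrt (inv_area_sq u v h)" "affine_circle c M = pencil_conic u v h"
proof -
  define \<delta> where "\<delta> = u * v - h\<^sup>2"
  have \<delta>: "\<delta> > 0" using assms by (simp add: \<delta>_def)
  have N: "pencil_det u v h > 0" using pencil_det_pos assms by simp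
  define K where "K = 1 + (v * ((1 - u) / 2)\<^sup>2 - 2 * h * ((1 - u) / 2) * ((1 - v) / 2) + u * ((1 - v) / 2)\<^sup>2) / \<delta>"
  have K: "K = pencil_det u v h / \<delta>"
  proof -
    have "pencil_det u v h = \<delta> + (v * ((1 - u) / 2)\<^sup>2
        - 2 * h * ((1 - u) / 2) * ((1 - v) / 2) + u * ((1 - v) / 2)\<^sup>2)"
      by (simp add: pencil_det_def \<delta>_def field_simps power2_eq_square)
    then show ?thesis using \<delta> by (simp add: K_def add_divide_distrib)
  qed
  then have "K > 0" using N \<delta> by simp
  then obtain c M where det: "det M = K / sqrt \<delta>" and eq: "affine_circle c M =
      {z. u * (z$1)\<^sup>2 + 2 * h * z$1 * z$2 + v * (z$2)\<^sup>2 + 2 * ((1 - u) / 2) * z$1 + 2 * ((1 - v) / 2) * z$2 = 1}"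
    using conic_eq_affine_circle[of u v h 1 "(1 - u) / 2" "(1 - v) / 2"] assms(1) \<delta>
    unfolding K_def \<delta>_def by blast
  have "sqrt (inv_area_sq u v h) = sqrt (\<delta>\<^sup>2 * \<delta>) / sqrt ((pencil_det u v h)\<^sup>2)"
    unfolding inv_area_sq_def \<delta>_def[symmetric] by (simp add: real_sqrt_divide power3_eq_cube power2_eq_square)
  also have "\<dots> = sqrt \<delta> / K"
    using \<delta> N unfolding K by (simp add: real_sqrt_mult)
  finally have "det M = 1 / sqrt (inv_area_sq u v h)" using det by simp
  moreover have "affine_circle c M = pencil_conic u v h"
    unfolding eq pencil_conic_def by (simp del: right_diff_distrib_numeral left_diff_distrib_numeral diff_divide_distrib)
  ultimately show thesis by (rule that)
qed

section \<open>Maximizing the inverse squared area over the pencil\<close>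

text \<open>Were there two roots in \<open>(- r, r)\<close>, the third root \<open>w\<close> would have to exceed \<open>r\<close> because \<open>G r > 0\<close>,
  and also lie below \<open>- r\<close> because \<open>G (- r) < 0\<close>.\<close>

lemma cubic_unique_root:
  fixes p q s r x y :: real
  defines "G \<equiv> \<lambda>z. - (z ^ 3) + p * z\<^sup>2 + q * z + s"
  assumes r: "r > 0" "G r > 0" "G (- r) < 0"
    and x: "\<bar>x\<bar> < r" "G x = 0" and y: "\<bar>y\<bar> < r" "G y = 0"
  shows "x = y"
proof (rule ccontr)
  assume "x \<noteq> y"
  define w where "w = p - x - y"
  \<comment> \<open>Vieta's formulas, with \<open>w\<close> the third root\<close>
  have "(x - y) * (q + w * (x + y) + x * y) = G x - G y"
    unfolding G_def w_def by algebra
  then have q: "q = - w * (x + y) - x * y" using x y \<open>x \<noteq> y\<close> by simp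
  have s: "s = w * x * y" using x(2) q unfolding G_def w_def by algebra
  have G: "G z = (z - x) * (z - y) * (w - z)" for z
    unfolding G_def q s w_def by algebra
  have "(r - x) * (r - y) > 0" "(r + x) * (r + y) > 0" using x y by (auto intro!: mult_pos_pos)
  moreover have "(r - x) * (r - y) * (w - r) > 0" using r(2) unfolding G .
  moreover have "(r + x) * (r + y) * (- w - r) > 0" using r(3) unfolding G by (simp add: algebra_simps)
  ultimately have "w - r > 0" "- w - r > 0" using zero_less_mult_pos by blast+
  then show False using r by simp
qed

text \<open>The logarithmic derivative leaves, apart from a factor without zeros in the open interval, the
  cubic \<open>3 * h * N h + (u * v - h\<^sup>2) * N' h\<close> with \<open>N\<close> the determinant \<open>pencil_det u v\<close>.\<close>

lemma inv_area_sq_derivative: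
  assumes "pencil_det u v h \<noteq> 0"
  defines "m \<equiv> (1 - u) * (1 - v)" and "k \<equiv> u * v + (v * (1 - u)\<^sup>2 + u * (1 - v)\<^sup>2) / 4"
  shows "(inv_area_sq u v has_real_derivative
    - 2 * (u * v - h\<^sup>2)\<^sup>2 / (pencil_det u v h) ^ 3
      * (- (h ^ 3) + (- m) * h\<^sup>2 + (3 * k - 2 * u * v) * h + (- m * u * v / 2))) (at h)"
proof -
  define N where "N = (\<lambda>h. k - h\<^sup>2 - m * h / 2)"
  have N: "pencil_det u v = N"
    by (simp add: fun_eq_iff pencil_det_def N_def m_def k_def field_simps)
  have f: "inv_area_sq u v = (\<lambda>h. (u * v - h\<^sup>2) ^ 3 / (N h)\<^sup>2)"
    by (simp add: fun_eq_iff inv_area_sq_def N)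
  have nz: "N h \<noteq> 0" using assms(1) N by simp
  have dN: "(N has_real_derivative - 2 * h - m / 2) (at h)"
    unfolding N_def by (auto intro!: derivative_eq_intros)
  have "(inv_area_sq u v has_real_derivative
     (3 * (u * v - h\<^sup>2)\<^sup>2 * (- 2 * h) * (N h)\<^sup>2 - (u * v - h\<^sup>2) ^ 3 * (2 * N h * (- 2 * h - m / 2)))
       / ((N h)\<^sup>2 * (N h)\<^sup>2)) (at h)"
    unfolding f using nz
    by (auto intro!: derivative_eq_intros dN simp: power2_eq_square)
  also have "(3 * (u * v - h\<^sup>2)\<^sup>2 * (- 2 * h) * (N h)\<^sup>2 - (u * v - h\<^sup>2) ^ 3 * (2 * N h * (- 2 * h - m / 2)))
       / ((N h)\<^sup>2 * (N h)\<^sup>2)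
     = - 2 * (u * v - h\<^sup>2)\<^sup>2 / (N h) ^ 3 * (3 * h * N h + (u * v - h\<^sup>2) * (- 2 * h - m / 2))"
  proof -
    have "(3 * d\<^sup>2 * (- 2 * h) * T\<^sup>2 - d ^ 3 * (2 * T * e)) / (T\<^sup>2 * T\<^sup>2)
        = - 2 * d\<^sup>2 / T ^ 3 * (3 * h * T + d * e)" if "T \<noteq> 0" for d T e :: real
    proof -
      have "3 * d\<^sup>2 * (- 2 * h) * T\<^sup>2 - d ^ 3 * (2 * T * e) = T * (- 2 * d\<^sup>2 * (3 * h * T + d * e))"
        "T\<^sup>2 * T\<^sup>2 = T * T ^ 3"
        by (simp_all add: algebra_simps power2_eq_square power3_eq_cube)
      then show ?thesis using that by simp
    qed
    then show ?thesis using nz by blast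
  qed
  also have "3 * h * N h + (u * v - h\<^sup>2) * (- 2 * h - m / 2)
     = - (h ^ 3) + (- m) * h\<^sup>2 + (3 * k - 2 * u * v) * h + (- m * u * v / 2)"
    unfolding N_def by (simp add: algebra_simps power2_eq_square power3_eq_cube)
  finally show ?thesis unfolding N .
qed

lemma inv_area_sq_unique_maximum:
  assumes "u > 0" "v > 0" "u \<noteq> v" "u * v \<noteq> 1"
  shows "\<exists>!h. h\<^sup>2 < u * v \<and> (\<forall>k. k\<^sup>2 < u * v \<longrightarrow> inv_area_sq u v k \<le> inv_area_sq u v h)"
proof -
  define r where "r = sqrt (u * v)"
  have r: "r > 0" "r\<^sup>2 = u * v" using assms by (auto simp: r_def)
  have sq: "h\<^sup>2 < u * v \<longleftrightarrow> \<bar>h\<bar> < r" "h\<^sup>2 \<le> u * v \<longleftrightarrow> \<bar>h\<bar> \<le> r" for h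
    using r abs_le_square_iff[of r h] abs_le_square_iff[of h r] by auto
  have pos: "pencil_det u v h > 0" if "\<bar>h\<bar> \<le> r" for h
    using pencil_det_pos assms that sq by blast
  have "continuous_on {-r..r} (inv_area_sq u v)"
  proof -
    have "continuous_on {-r..r} (pencil_det u v)"
      unfolding pencil_det_def by (intro continuous_intros) auto
    moreover have "\<forall>h\<in>{-r..r}. (pencil_det u v h)\<^sup>2 \<noteq> 0"
      using pos by (auto simp: abs_le_iff less_imp_neq[symmetric] simp del: power_eq_0_iff intro!: power_not_zero)
    ultimately show ?thesis unfolding inv_area_sq_def by (intro continuous_intros) auto
  qed
  then obtain h where h: "h \<in> {-r..r}" "\<And>k. k \<in> {-r..r} \<Longrightarrow> inv_area_sq u v k \<le> inv_area_sq u v h"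
    using continuous_attains_sup[of "{-r..r}" "inv_area_sq u v"] r by auto
  \<comment> \<open>The function is positive at 0 and vanishes at the end points, so the maximum is interior.\<close>
  have "0 < inv_area_sq u v 0" using inv_area_sq_pos[of u v 0] assms by simp
  also have "\<dots> \<le> inv_area_sq u v h" using h(2)[of 0] r by simp
  finally have "h\<^sup>2 \<noteq> u * v" by (auto simp: inv_area_sq_def)
  then have h1: "h\<^sup>2 < u * v" using h(1) sq[of h] by (auto simp: abs_le_iff)
  define m where "m = (1 - u) * (1 - v)"
  define k where "k = u * v + (v * (1 - u)\<^sup>2 + u * (1 - v)\<^sup>2) / 4"
  define G where "G = (\<lambda>h. - (h ^ 3) + (- m) * h\<^sup>2 + (3 * k - 2 * u * v) * h + (- m * u * v / 2))"
  \<comment> \<open>In this form the second summand visibly vanishes at both end points.\<close>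
  have G: "G h = 3 * h * pencil_det u v h + (u * v - h\<^sup>2) * (- 2 * h - m / 2)" for h
    unfolding G_def m_def k_def pencil_det_def by (simp add: field_simps power2_eq_square power3_eq_cube)
  have crit: "G h = 0" if "h\<^sup>2 < u * v" "\<forall>k. k\<^sup>2 < u * v \<longrightarrow> inv_area_sq u v k \<le> inv_area_sq u v h" for h
  proof -
    have h: "\<bar>h\<bar> < r" using that sq by simp
    have c: "pencil_det u v h > 0" using pos h by simp
    have "- 2 * (u * v - h\<^sup>2)\<^sup>2 / (pencil_det u v h) ^ 3 * G h = 0"
    proof (rule DERIV_local_max[where d = "r - \<bar>h\<bar>"])
      show "(inv_area_sq u v has_real_derivative
          - 2 * (u * v - h\<^sup>2)\<^sup>2 / (pencil_det u v h) ^ 3 * G h) (at h)"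
        using inv_area_sq_derivative[of u v h] c unfolding G_def m_def k_def by simp
      show "\<forall>y. \<bar>h - y\<bar> < r - \<bar>h\<bar> \<longrightarrow> inv_area_sq u v y \<le> inv_area_sq u v h"
        using that(2) sq by (auto simp: abs_if split: if_splits)
    qed (use h in simp)
    then show ?thesis using c that(1) by simp
  qed
  have ends: "G r > 0" "G (- r) < 0"
    using pos[of r] pos[of "- r"] r by (simp_all add: G zero_less_mult_iff)
  show ?thesis
  proof (rule ex1I[of _ h])
    show max: "h\<^sup>2 < u * v \<and> (\<forall>k. k\<^sup>2 < u * v \<longrightarrow> inv_area_sq u v k \<le> inv_area_sq u v h)"
      using h1 sq by (auto intro!: h(2))
    fix y assume y: "y\<^sup>2 < u * v \<and> (\<forall>k. k\<^sup>2 < u * v \<longrightarrow> inv_area_sq u v k \<le> inv_area_sq u v y)"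
    then have "G y = 0" "G h = 0" using crit max by blast+
    then show "y = h"
      using cubic_unique_root[of r "- m" "3 * k - 2 * u * v" "- m * u * v / 2" y h] r ends y h1 sq
      unfolding G_def by blast
  qed
qed

section \<open>The diagonals of a convex quadrilateral as coordinate axes\<close>

definition cross2 :: "real^2 \<Rightarrow> real^2 \<Rightarrow> real" where
  "cross2 p q = p$1 * q$2 - p$2 * q$1"

lemma cross2_coords_unique:
  assumes "cross2 p q \<noteq> 0" "x *\<^sub>R p + y *\<^sub>R q = x' *\<^sub>R p + y' *\<^sub>R q"
  shows "x = x'" "y = y'"
proof -
  have "x * p$i + y * q$i = x' * p$i + y' * q$i" for i
    using arg_cong[OF assms(2), of "\<lambda>v. v $ i"] by simp
  from this[of 1] this[of 2] have "(x - x') * cross2 p q = 0" "(y - y') * cross2 p q = 0"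
    unfolding cross2_def by algebra+
  then show "x = x'" "y = y'" using assms(1) by auto
qed

lemma cross2_eq_0:
  assumes "p \<noteq> 0" "cross2 p q = 0"
  obtains k where "q = k *\<^sub>R p"
proof -
  have eq: "p$1 * q$2 = p$2 * q$1" using assms(2) by (simp add: cross2_def)
  have "p$1 \<noteq> 0 \<or> p$2 \<noteq> 0" using assms(1) by (auto simp: vec_eq_iff forall_2)
  then show thesis
  proof
    assume "p$1 \<noteq> 0"
    then show thesis using eq that[of "q$1 / p$1"] by (simp add: vec_eq_iff forall_2 field_simps)
  next
    assume "p$2 \<noteq> 0"
    then show thesis using eq that[of "q$2 / p$2"] by (simp add: vec_eq_iff forall_2 field_simps)
  qed
qed

lemma between_opposite:
  fixes A C Z :: "'a::real_vector"
  assumes "Z \<in> convex hull {A, C}" "Z \<noteq> A" "Z \<noteq> C"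
  obtains s where "s > 0" "C = Z - s *\<^sub>R (A - Z)"
proof -
  obtain l where l: "0 \<le> l" "l \<le> 1" "Z = (1 - l) *\<^sub>R A + l *\<^sub>R C"
    using assms(1) unfolding segment_convex_hull[symmetric] closed_segment_def by auto
  then have "l \<noteq> 0" "l \<noteq> 1" using assms by auto
  then have "l > 0" "l < 1" using l by auto
  have "A - Z = l *\<^sub>R (A - C)" "Z - C = (1 - l) *\<^sub>R (A - C)"
    using l(3) by (simp_all add: algebra_simps)
  then have "Z - C = ((1 - l) / l) *\<^sub>R (A - Z)" using \<open>l > 0\<close> by simp
  then have "C = Z - ((1 - l) / l) *\<^sub>R (A - Z)" by (simp add: algebra_simps)
  then show thesis using that[of "(1 - l) / l"] \<open>l > 0\<close> \<open>l < 1\<close> by simp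
qed

lemma in_hull_opposite:
  fixes Z p :: "'a::real_vector"
  assumes "s > 0" "- s \<le> m" "m \<le> 1"
  shows "Z + m *\<^sub>R p \<in> convex hull {Z + p, Z - s *\<^sub>R p}"
proof -
  define l where "l = (m + s) / (1 + s)"
  have "0 \<le> l" "l \<le> 1" using assms by (auto simp: l_def field_simps)
  moreover have "l * (1 + s) = m + s" using assms(1) by (simp add: l_def)
  then have m: "m = l - (1 - l) * s" by (simp add: algebra_simps)
  then have "Z + m *\<^sub>R p = l *\<^sub>R (Z + p) + (1 - l) *\<^sub>R (Z - s *\<^sub>R p)"
    unfolding m by (simp add: algebra_simps)
  ultimately have "\<exists>a b. 0 \<le> a \<and> 0 \<le> b \<and> a + b = 1 \<and>
      Z + m *\<^sub>R p = a *\<^sub>R (Z + p) + b *\<^sub>R (Z - s *\<^sub>R p)"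
    by (metis add.commute diff_add_cancel diff_ge_0_iff_ge)
  then show ?thesis unfolding convex_hull_2 by blast
qed

text \<open>By Radon's theorem the four points split into two parts whose convex hulls meet in a point \<open>Z\<close>.
  A part with a single point would put that point in the hull of the other three, so both parts are
  pairs, namely the diagonals. The vectors \<open>p\<close> and \<open>q\<close> run from \<open>Z\<close> to one end of each diagonal.\<close>

lemma convexly_independent_diagonals:
  fixes V :: "(real^2) set"
  assumes card: "card V = 4" and indep: "\<And>x. x \<in> V \<Longrightarrow> x \<notin> convex hull (V - {x})"
  obtains Z p q s t where "s > 0" "t > 0" "cross2 p q \<noteq> 0"
    "V = {Z + p, Z - s *\<^sub>R p, Z + q, Z - t *\<^sub>R q}"
proof -
  have fin: "finite V" using card card.infinite by fastforce
  have "affine_dependent V" using affine_dependent_biggerset[OF fin] card by simp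
  then obtain M P where MP: "M \<inter> P = {}" "M \<union> P = V" "convex hull M \<inter> convex hull P \<noteq> {}"
    using Radon_partition[OF fin] by blast
  have finMP: "finite M" "finite P" using fin MP(2) by auto
  have not1: "card M' \<noteq> 0 \<and> card M' \<noteq> 1"
    if "M' \<inter> P' = {}" "M' \<union> P' = V" "convex hull M' \<inter> convex hull P' \<noteq> {}" for M' P'
  proof (intro conjI notI)
    assume "card M' = 0"
    moreover have "finite M'" using fin that(2) by auto
    ultimately show False using that(3) by simp
  next
    assume "card M' = 1"
    then obtain x where x: "M' = {x}" by (rule card_1_singletonE)
    then have "P' = V - {x}" "x \<in> V" using that by auto
    then show False using indep that(3) x by auto
  qed
  have "card M + card P = 4" using card_Un_disjoint[OF finMP MP(1)] MP(2) card by simp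
  moreover have "card M \<noteq> 0 \<and> card M \<noteq> 1" using not1 MP by blast
  moreover have "card P \<noteq> 0 \<and> card P \<noteq> 1" using not1[of P M] MP by blast
  ultimately have "card M = 2" "card P = 2" by linarith+
  then obtain A B C D where M: "M = {A, C}" "A \<noteq> C" and P: "P = {B, D}" "B \<noteq> D"
    by (auto simp: card_2_iff)
  obtain Z where Z: "Z \<in> convex hull {A, C}" "Z \<in> convex hull {B, D}"
    using MP(3) M P by auto
  have V: "V = {A, C, B, D}" using MP(2) M P by auto
  have out: "A \<notin> convex hull {B, D}" "C \<notin> convex hull {B, D}"
    "B \<notin> convex hull {A, C}" "D \<notin> convex hull {A, C}"
  proof -
    have "x \<notin> convex hull T" if "x \<in> V" "T \<subseteq> V - {x}" for x T
      using indep[OF that(1)] hull_mono[OF that(2), of convex] by blast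
    then show "A \<notin> convex hull {B, D}" "C \<notin> convex hull {B, D}"
      "B \<notin> convex hull {A, C}" "D \<notin> convex hull {A, C}"
      using MP(1) unfolding M P V by auto
  qed
  obtain s where s: "s > 0" "C = Z - s *\<^sub>R (A - Z)"
    using between_opposite[OF Z(1)] out Z(2) by metis
  obtain t where t: "t > 0" "D = Z - t *\<^sub>R (B - Z)"
    using between_opposite[OF Z(2)] out Z(1) by metis
  define p q where "p = A - Z" and "q = B - Z"
  have A: "A = Z + p" and B: "B = Z + q" and C: "C = Z - s *\<^sub>R p" and D: "D = Z - t *\<^sub>R q"
    using s t by (simp_all add: p_def q_def)
  have "cross2 p q \<noteq> 0"
  proof
    assume "cross2 p q = 0"
    moreover have "p \<noteq> 0" using out(1) Z(2) by (auto simp: p_def)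
    ultimately obtain k where k: "q = k *\<^sub>R p" using cross2_eq_0 by blast
    \<comment> \<open>If the diagonals were collinear, then \<open>B\<close> would lie between \<open>A\<close> and \<open>C\<close>, or beyond one of
      these two points, and that point would lie between \<open>B\<close> and \<open>D\<close>.\<close>
    consider "k > 1" | "- s \<le> k" "k \<le> 1" | "k < - s" by linarith
    then show False
    proof cases
      case 1
      then have "A = Z + (1 / k) *\<^sub>R q" by (simp add: A k)
      also have "\<dots> \<in> convex hull {B, D}"
        unfolding B D using 1 t(1) by (intro in_hull_opposite) (auto simp: field_simps intro: order_trans[of _ 0])
      finally show False using out by simp
    next
      case 2
      then show False using in_hull_opposite[OF s(1) 2, of Z p] out unfolding A B C k by simp
    next
      case 3
      then have "C = Z + (- s / k) *\<^sub>R q" using s(1) by (simp add: C k)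
      also have "\<dots> \<in> convex hull {B, D}"
      proof -
        have "- s / k > 0" "- s / k \<le> 1" using 3 s(1) by (simp_all add: field_simps)
        then show ?thesis unfolding B D using t(1) by (intro in_hull_opposite) auto
      qed
      finally show False using out by simp
    qed
  qed
  then show thesis using that[of s t p q Z] s(1) t(1) V unfolding A B C D by blast
qed

text \<open>If \<open>Z\<close> divides both diagonals in the same ratio, the homothety with center \<open>Z\<close> and factor \<open>- s\<close>
  maps one side to the opposite one, so these two sides are parallel. The two segments are indeed
  sides: in the coordinates along \<open>p\<close> and \<open>q\<close>, the sum of the coordinates is \<open>1\<close> on one line and \<open>- s\<close>
  on the other, so each line misses the convex hull of the two remaining vertices.\<close>

lemma trapezoid_if_equal_ratios:
  assumes quad: "convex_quadrilateral (convex hull V)" and st: "s > 0"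
    and pq: "cross2 p q \<noteq> 0"
    and V: "V = {Z + p, Z - s *\<^sub>R p, Z + q, Z - s *\<^sub>R q}"
  shows "trapezoid (convex hull V)"
proof -
  let ?AB = "{Z + p, Z + q}" and ?CD = "{Z - s *\<^sub>R p, Z - s *\<^sub>R q}"
  have AB: "x \<in> affine hull ?AB \<longleftrightarrow> (\<exists>u. x = Z + ((1 - u) *\<^sub>R p + u *\<^sub>R q))" for x
  proof -
    have "Z + p + u *\<^sub>R (Z + q - (Z + p)) = Z + ((1 - u) *\<^sub>R p + u *\<^sub>R q)" for u
      by (simp add: algebra_simps)
    then show ?thesis unfolding affine_hull_2_alt by auto
  qed
  have CD: "x \<in> affine hull ?CD \<longleftrightarrow> (\<exists>u. x = Z + ((- s * (1 - u)) *\<^sub>R p + (- s * u) *\<^sub>R q))" for x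
  proof -
    have "Z - s *\<^sub>R p + u *\<^sub>R (Z - s *\<^sub>R q - (Z - s *\<^sub>R p))
        = Z + ((- s * (1 - u)) *\<^sub>R p + (- s * u) *\<^sub>R q)" for u
      by (simp add: algebra_simps)
    then show ?thesis unfolding affine_hull_2_alt by auto
  qed
  have disj: "affine hull ?AB \<inter> affine hull ?CD = {}"
  proof -
    have False if "x \<in> affine hull ?AB" "x \<in> affine hull ?CD" for x
    proof -
      obtain u w where "(1 - u) *\<^sub>R p + u *\<^sub>R q = (- s * (1 - w)) *\<^sub>R p + (- s * w) *\<^sub>R q"
        using \<open>x \<in> affine hull ?AB\<close> \<open>x \<in> affine hull ?CD\<close> unfolding AB CD by auto
      from cross2_coords_unique[OF pq this] have "(1 - u) + u = - s * (1 - w) + - s * w" by argo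
      then show False using st by (simp add: algebra_simps)
    qed
    then show ?thesis by blast
  qed
  have ne: "Z + p \<noteq> Z + q" "Z - s *\<^sub>R p \<noteq> Z - s *\<^sub>R q"
    using pq st by (auto simp: cross2_def)
  have edge: "convex hull {a, b} edge_of convex hull V"
    if "{a, b} \<subseteq> V" "V - {a, b} \<subseteq> T" "affine hull {a, b} \<inter> affine hull T = {}" "a \<noteq> b" for a b T
  proof -
    have "convex hull (V - {a, b}) \<subseteq> affine hull T"
      using hull_mono[OF that(2), of convex] convex_hull_subset_affine_hull[of T] by blast
    then have "convex hull {a, b} face_of convex hull V"
      using that(1,3) by (intro face_of_convex_hulls) (auto simp: V)
    then show ?thesis using that(4) by (simp add: edge_of_def aff_dim_convex_hull aff_dim_2)
  qed
  have "convex hull ?AB edge_of convex hull V"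
    by (rule edge[of _ _ ?CD]) (use V disj ne in auto)
  moreover have "convex hull ?CD edge_of convex hull V"
    by (rule edge[of _ _ ?AB]) (use V disj ne in auto)
  moreover have "convex hull ?AB \<noteq> convex hull ?CD"
  proof
    assume "convex hull ?AB = convex hull ?CD"
    then have "Z + p \<in> convex hull ?CD" by (metis hull_inc insertI1)
    then have "Z + p \<in> affine hull ?CD" using convex_hull_subset_affine_hull by blast
    moreover have "Z + p \<in> affine hull ?AB" by (simp add: hull_inc)
    ultimately show False using disj by blast
  qed
  moreover have "affine_parallel (affine hull ?AB) (affine hull ?CD)"
    unfolding affine_parallel_def
  proof (intro exI set_eqI)
    fix x
    have "x \<in> affine hull ?CD \<longleftrightarrow> x + (1 + s) *\<^sub>R p \<in> affine hull ?AB"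
    proof
      assume "x \<in> affine hull ?CD"
      then obtain u where "x = Z + ((- s * (1 - u)) *\<^sub>R p + (- s * u) *\<^sub>R q)" unfolding CD by blast
      then show "x + (1 + s) *\<^sub>R p \<in> affine hull ?AB"
        unfolding AB by (intro exI[of _ "- s * u"]) (simp add: algebra_simps)
    next
      assume "x + (1 + s) *\<^sub>R p \<in> affine hull ?AB"
      then obtain u where "x = Z + ((1 - u) *\<^sub>R p + u *\<^sub>R q) - (1 + s) *\<^sub>R p"
        unfolding AB by (metis add_diff_cancel_right')
      then show "x \<in> affine hull ?CD"
        unfolding CD using st by (intro exI[of _ "- u / s"]) (simp add: algebra_simps)
    qed
    then show "x \<in> affine hull ?CD \<longleftrightarrow> x \<in> (\<lambda>x. - (1 + s) *\<^sub>R p + x) ` (affine hull ?AB)"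
      by (force simp: image_iff algebra_simps)
  qed
  ultimately show ?thesis using quad unfolding trapezoid_def affine_hull_convex_hull[symmetric, of ?AB]
    by (metis affine_hull_convex_hull)
qed

lemma quadrilateral_diagonal_frame:
  assumes quad: "convex_quadrilateral R" and ntrap: "\<not> trapezoid R"
  obtains Z p q s t where "s > 0" "t > 0" "s \<noteq> t" "s * t \<noteq> 1" "cross2 p q \<noteq> 0"
    "vertices R = {Z + p, Z - s *\<^sub>R p, Z + q, Z - t *\<^sub>R q}"
proof -
  have R: "compact R" "convex R"
    using quad by (auto simp: convex_quadrilateral_def polytope_imp_compact polytope_imp_convex)
  have hull: "R = convex hull (vertices R)"
    unfolding vertices_def using Krein_Milman_Minkowski[OF R] .
  have "x \<notin> convex hull (vertices R - {x})" if "x \<in> vertices R" for x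
  proof -
    have "convex (R - {x})"
      using that extreme_point_of_stillconvex[OF R(2), of x] by (simp add: vertices_def)
    moreover have "vertices R - {x} \<subseteq> R - {x}"
      by (auto simp: vertices_def extreme_point_of_def)
    ultimately have "convex hull (vertices R - {x}) \<subseteq> R - {x}" by (simp add: hull_minimal)
    then show ?thesis by blast
  qed
  moreover have "card (vertices R) = 4" using quad by (simp add: convex_quadrilateral_def)
  ultimately obtain Z p q s t where st: "s > 0" "t > 0" and pq: "cross2 p q \<noteq> 0"
    and V: "vertices R = {Z + p, Z - s *\<^sub>R p, Z + q, Z - t *\<^sub>R q}"
    using convexly_independent_diagonals by metis
  have "s \<noteq> t"
    using trapezoid_if_equal_ratios[of "vertices R" s p q Z] quad ntrap st pq V hull by metis
  moreover have "s * t \<noteq> 1"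
  proof
    assume "s * t = 1"
    \<comment> \<open>Reversing the second diagonal replaces \<open>q\<close> by \<open>- t *\<^sub>R q\<close> and its ratio \<open>t\<close> by \<open>1 / t = s\<close>,
      and exchanges the two pairs of opposite sides.\<close>
    then have "s * t = 1" "t * s = 1" by (simp_all add: mult.commute)
    then have "vertices R = {Z + p, Z - s *\<^sub>R p, Z + (- t *\<^sub>R q), Z - s *\<^sub>R (- t *\<^sub>R q)}"
      unfolding V by auto
    moreover have "cross2 p (- t *\<^sub>R q) = - t * cross2 p q" by (simp add: cross2_def algebra_simps)
    then have "cross2 p (- t *\<^sub>R q) \<noteq> 0" using pq st by simp
    ultimately show False
      using trapezoid_if_equal_ratios[of "vertices R" s p "- t *\<^sub>R q" Z] quad ntrap st hull by metis
  qed
  ultimately show thesis using that st pq V by blast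
qed

section \<open>Existence and uniqueness\<close>

text \<open>Pulling an ellipse back along the affine frame gives an affine image of the unit circle through the
  four points on the axes, which belongs to the pencil; and conversely.\<close>

lemma circumscribed_ellipses_eq_pencil:
  assumes uv: "u > 0" "v > 0" "u \<noteq> v" "u * v \<noteq> 1" and det: "det P \<noteq> 0"
    and V: "vertices R = (\<lambda>x. Z + P *v x) ` axis_quadrilateral u v"
  shows "circumscribed_ellipses R = (\<lambda>h. (\<lambda>x. Z + P *v x) ` pencil_conic u v h) ` {h. h\<^sup>2 < u * v}"
proof (intro subset_antisym subsetI)
  fix E assume "E \<in> circumscribed_ellipses R"
  then obtain c M where M: "det M \<noteq> 0" and E: "E = affine_circle c M"
    and sub: "(\<lambda>x. Z + P *v x) ` axis_quadrilateral u v \<subseteq> E"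
    unfolding circumscribed_ellipses_def ellipse_iff_affine_circle V by blast
  obtain P' where P': "P ** P' = mat 1" "P' ** P = mat 1"
    using det unfolding invertible_det_nz[symmetric] invertible_def by auto
  have "det P' * det P = 1" using P'(2) det_mul[of P' P] by simp
  then have det': "det (P' ** M) \<noteq> 0" using M by (auto simp: det_mul)
  let ?T = "\<lambda>x. Z + P *v x" and ?T' = "\<lambda>x. - (P' *v Z) + P' *v x"
  have inv: "?T' (?T x) = x" "?T (?T' x) = x" for x
    by (simp_all add: matrix_vector_right_distrib matrix_vector_mult_diff_distrib
        matrix_vector_mul_assoc P' flip: diff_conv_add_uminus add: uminus_add_conv_diff)
  have E': "?T' ` E = affine_circle (- (P' *v Z) + P' *v c) (P' ** M)"
    unfolding E by (rule affine_image_affine_circle)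
  have "?T' ` (?T ` axis_quadrilateral u v) \<subseteq> ?T' ` E" using sub by (rule image_mono)
  then have "axis_quadrilateral u v \<subseteq> ?T' ` E" by (simp only: image_image inv image_ident)
  then obtain h where h: "h\<^sup>2 < u * v" "?T' ` E = pencil_conic u v h"
    using affine_circle_through_axis_quadrilateral[OF uv(1,2) det', of "- (P' *v Z) + P' *v c"] unfolding E' by blast
  have "E = ?T ` (?T' ` E)" by (simp only: image_image inv image_ident)
  then show "E \<in> (\<lambda>h. ?T ` pencil_conic u v h) ` {h. h\<^sup>2 < u * v}" using h by auto
next
  fix E assume "E \<in> (\<lambda>h. (\<lambda>x. Z + P *v x) ` pencil_conic u v h) ` {h. h\<^sup>2 < u * v}"
  then obtain h where h: "h\<^sup>2 < u * v" and E: "E = (\<lambda>x. Z + P *v x) ` pencil_conic u v h" by auto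
  obtain c M where M: "det M = 1 / sqrt (inv_area_sq u v h)" "affine_circle c M = pencil_conic u v h"
    using pencil_conic_eq_affine_circle[OF uv h] .
  have "E = affine_circle (Z + P *v c) (P ** M)"
    unfolding E M(2)[symmetric] by (rule affine_image_affine_circle)
  moreover have "det (P ** M) \<noteq> 0" using det inv_area_sq_pos[OF uv h] by (simp add: det_mul M)
  ultimately have "ellipse E" unfolding ellipse_iff_affine_circle by blast
  then show "E \<in> circumscribed_ellipses R"
    using axis_quadrilateral_subset_pencil_conic[OF uv(1,2)] unfolding circumscribed_ellipses_def V E by auto
qed

lemma enclosed_area_pencil_conic:
  assumes "u > 0" "v > 0" "u \<noteq> v" "u * v \<noteq> 1" "h\<^sup>2 < u * v" and det: "det P \<noteq> 0"
  shows "enclosed_area ((\<lambda>x. Z + P *v x) ` pencil_conic u v h)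
    = pi * \<bar>det P\<bar> / sqrt (inv_area_sq u v h)"
proof -
  have f: "inv_area_sq u v h > 0" using inv_area_sq_pos[OF assms(1-5)] .
  obtain c M where M: "det M = 1 / sqrt (inv_area_sq u v h)" "affine_circle c M = pencil_conic u v h"
    using pencil_conic_eq_affine_circle[OF assms(1-5)] .
  have "det (P ** M) \<noteq> 0" using det f by (simp add: det_mul M)
  then show ?thesis
    unfolding M(2)[symmetric] affine_image_affine_circle
    using f by (simp add: enclosed_area_affine_circle det_mul M abs_mult)
qed

theorem theorem2:
  fixes R :: "(real^2) set"
  assumes "convex_quadrilateral R" and "\<not> trapezoid R"
  shows "\<exists>!E. E \<in> circumscribed_ellipses R \<and>
           (\<forall>E' \<in> circumscribed_ellipses R. enclosed_area E \<le> enclosed_area E')"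
proof -
  obtain Z p q s t where st: "s > 0" "t > 0" "s \<noteq> t" "s * t \<noteq> 1" and pq: "cross2 p q \<noteq> 0"
    and V: "vertices R = {Z + p, Z - s *\<^sub>R p, Z + q, Z - t *\<^sub>R q}"
    using quadrilateral_diagonal_frame[OF assms] .
  define u v where "u = 1 / s" and "v = 1 / t"
  have uv: "u > 0" "v > 0" "u \<noteq> v" "u * v \<noteq> 1" using st by (auto simp: u_def v_def)
  define P :: "real^2^2" where "P = vector [vector [p$1, q$1], vector [p$2, q$2]]"
  have det: "det P \<noteq> 0" using pq by (simp add: P_def det_2 cross2_def mult.commute)
  let ?C = "\<lambda>h. (\<lambda>x. Z + P *v x) ` pencil_conic u v h" and ?I = "{h. h\<^sup>2 < u * v}"
  have P: "P *v vector [x, y] = x *\<^sub>R p + y *\<^sub>R q" for x y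
    by (simp add: P_def vec_eq_iff forall_2 matrix_vector_mult_def sum_2)
  have "vertices R = (\<lambda>x. Z + P *v x) ` axis_quadrilateral u v"
    unfolding V axis_quadrilateral_def by (simp add: P u_def v_def)
  then have circ: "circumscribed_ellipses R = ?C ` ?I"
    using circumscribed_ellipses_eq_pencil[OF uv det] by blast
  have area_le: "enclosed_area (?C h) \<le> enclosed_area (?C k) \<longleftrightarrow> inv_area_sq u v k \<le> inv_area_sq u v h"
    if "h \<in> ?I" "k \<in> ?I" for h k
  proof -
    have "inv_area_sq u v h > 0" "inv_area_sq u v k > 0" using inv_area_sq_pos[OF uv] that by auto
    moreover have "pi * \<bar>det P\<bar> > 0" using det by simp
    moreover have "c / x \<le> c / y \<longleftrightarrow> y \<le> x" if "c > 0" "x > 0" "y > 0" for c x y :: real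
      using that by (simp add: field_simps)
    ultimately show ?thesis
      using that uv det by (simp add: enclosed_area_pencil_conic)
  qed
  obtain h where max: "h\<^sup>2 < u * v \<and> (\<forall>k. k\<^sup>2 < u * v \<longrightarrow> inv_area_sq u v k \<le> inv_area_sq u v h)"
    and unique: "\<And>y. y\<^sup>2 < u * v \<and> (\<forall>k. k\<^sup>2 < u * v \<longrightarrow> inv_area_sq u v k \<le> inv_area_sq u v y) \<Longrightarrow> y = h"
    using inv_area_sq_unique_maximum[OF uv] by (elim ex1E) blast
  have h: "h \<in> ?I" "\<forall>k\<in>?I. inv_area_sq u v k \<le> inv_area_sq u v h" using max by blast+
  show ?thesis
  proof (rule ex1I[of _ "?C h"])
    show "?C h \<in> circumscribed_ellipses R \<and>
        (\<forall>E'\<in>circumscribed_ellipses R. enclosed_area (?C h) \<le> enclosed_area E')"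
      unfolding circ using h area_le by blast
    fix E assume E: "E \<in> circumscribed_ellipses R \<and>
        (\<forall>E'\<in>circumscribed_ellipses R. enclosed_area E \<le> enclosed_area E')"
    then obtain y where y: "y \<in> ?I" "E = ?C y" unfolding circ by blast
    then have "\<forall>k\<in>?I. inv_area_sq u v k \<le> inv_area_sq u v y"
      using E area_le unfolding circ by blast
    then show "E = ?C h" using unique y by blast
  qed
qed

end
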